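(* Let $n>3$ be an odd integer and let $\varepsilon\in\{-1,1\}$. Then there exists an edge-regular Deza graph with parameters $$ \left( \frac{5^{n-1} + \varepsilon 5^{\frac{n-1}{2}}}{2},\; 5^{n-2} - \varepsilon 5^{\frac{n-3}{2}},\; 2\bigl(5^{n-3} - \varepsilon 5^{\frac{n-3}{2}}\bigr),\; 2 \cdot 5^{n-3} - \varepsilon 5^{\frac{n-3}{2}} \right) $$ whose two children are strongly regular graphs: the child in which two distinct vertices are adjacent iff they have $2(5^{n-3} - \varepsilon 5^{\frac{n-3}{2}})$ common neighbours is strongly regular with parameters $$ \left( \frac{5^{n-1} + \varepsilon 5^{\frac{n-1}{2}}}{2},\; \frac{5^{n-2} - \varepsilon 5^{\frac{n-3}{2}}}{2},\; \frac{5^{n-3} + \varepsilon 5^{\frac{n-3}{2}}}{2},\; \frac{5^{n-3} - \varepsilon 5^{\frac{n-3}{2}}}{2} \right), $$ and the child in which two distinct vertices are adjacent iff they have $2 \cdot 5^{n-3} - \varepsilon 5^{\frac{n-3}{2}}$ common neighbours is strongly regular with parameters $$ \left( \frac{5^{n-1} + \varepsilon 5^{\frac{n-1}{2}}}{2},\; 2\cdot 5^{n-2} + 3\varepsilon 5^{\frac{n-3}{2}}-1,\; 8\cdot 5^{n-3} + 3\varepsilon 5^{\frac{n-3}{2}}-2,\; 8\cdot 5^{n-3} + 4\varepsilon 5^{\frac{n-3}{2}} \right). $$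
   Context: Graphs are finite, simple and undirected; $\Gamma(v)$ denotes the set of neighbours of $v$. A graph is a Deza graph with parameters $(N,k,b,a)$ if it has $N$ vertices, is $k$-regular, and $|\Gamma(u)\cap\Gamma(v)|\in\{a,b\}$ for any two distinct vertices $u,v$ (no order between $a$ and $b$ is imposed here). If $a\neq b$, the children of a Deza graph are the two graphs on the same vertex set in which two distinct vertices are adjacent iff they have exactly $a$ (respectively exactly $b$) common neighbours. A regular graph is edge-regular if any two adjacent vertices have the same number of common neighbours. A graph is strongly regular with parameters $(N,k,\lambda,\mu)$ if it has $N$ vertices, is $k$-regular, any two adjacent vertices have exactly $\lambda$ common neighbours, and any two distinct non-adjacent vertices have exactly $\mu$ common neighbours. *)

theory Defs
  imports "Graph_Theory.Pair_Digraph"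
begin

(* A finite simple undirected graph is a symmetric, irreflexive relation on a finite vertex set,
   i.e. the library locale pair_graph: an edge {u, v} is stored as the two arcs (u, v), (v, u). *)

definition neighbours :: "'a pair_pre_digraph \<Rightarrow> 'a \<Rightarrow> 'a set" where
  "neighbours G v = {u. (v, u) \<in> parcs G}"

(* All parameters are integers, so that formulas containing subtractions and signs
   can be written down without truncation. *)

definition common_nbrs :: "'a pair_pre_digraph \<Rightarrow> 'a \<Rightarrow> 'a \<Rightarrow> int" where
  "common_nbrs G u v = int (card (neighbours G u \<inter> neighbours G v))"

definition regular_graph :: "'a pair_pre_digraph \<Rightarrow> int \<Rightarrow> bool" where
  "regular_graph G k \<longleftrightarrow>
     pair_graph G \<and> (\<forall>v \<in> pverts G. int (card (neighbours G v)) = k)"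

definition deza_graph :: "'a pair_pre_digraph \<Rightarrow> int \<Rightarrow> int \<Rightarrow> int \<Rightarrow> int \<Rightarrow> bool" where
  "deza_graph G N k b a \<longleftrightarrow>
     regular_graph G k \<and> int (card (pverts G)) = N \<and>
     (\<forall>u \<in> pverts G. \<forall>v \<in> pverts G. u \<noteq> v \<longrightarrow> common_nbrs G u v \<in> {a, b})"

definition edge_regular :: "'a pair_pre_digraph \<Rightarrow> bool" where
  "edge_regular G \<longleftrightarrow>
     (\<exists>k. regular_graph G k) \<and>
     (\<exists>l. \<forall>u \<in> pverts G. \<forall>v \<in> pverts G. (u, v) \<in> parcs G \<longrightarrow> common_nbrs G u v = l)"

definition strongly_regular :: "'a pair_pre_digraph \<Rightarrow> int \<Rightarrow> int \<Rightarrow> int \<Rightarrow> int \<Rightarrow> bool" where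
  "strongly_regular G N k l m \<longleftrightarrow>
     regular_graph G k \<and> int (card (pverts G)) = N \<and>
     (\<forall>u \<in> pverts G. \<forall>v \<in> pverts G. (u, v) \<in> parcs G \<longrightarrow> common_nbrs G u v = l) \<and>
     (\<forall>u \<in> pverts G. \<forall>v \<in> pverts G. u \<noteq> v \<and> (u, v) \<notin> parcs G \<longrightarrow> common_nbrs G u v = m)"

(* The children of a Deza graph with parameters (N, k, b, a), a \<noteq> b,
   are deza_child G a and deza_child G b. *)

definition deza_child :: "'a pair_pre_digraph \<Rightarrow> int \<Rightarrow> 'a pair_pre_digraph" where
  "deza_child G c =
     \<lparr> pverts = pverts G,
       parcs = {(u, v). u \<in> pverts G \<and> v \<in> pverts G \<and> u \<noteq> v \<and> common_nbrs G u v = c} \<rparr>"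

lemma pair_graph_deza_child:
  assumes "pair_graph G"
  shows "pair_graph (deza_child G c)"
proof -
  interpret pair_graph G by fact
  have "parcs (deza_child G c) \<subseteq> pverts G \<times> pverts G"
    by (auto simp: deza_child_def)
  then have "finite (parcs (deza_child G c))"
    using pair_finite_verts by (meson finite_SigmaI finite_subset)
  then show ?thesis
    using pair_finite_verts
    by unfold_locales
       (auto simp: deza_child_def symmetric_def common_nbrs_def Int_commute intro!: symI)
qed

(* The halves in the parameter formulas are exact: a sum or difference of two powers of 5 is even. *)

lemma even_pow5:
  fixes e :: int and i j :: nat
  assumes "e \<in> {-1, 1}"
  shows "even ((5::int) ^ i + e * 5 ^ j)" and "even ((5::int) ^ i - e * 5 ^ j)"
  using assms by auto

lemma deza_parameters_distinct:
  fixes e :: int and i j :: nat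
  assumes "e \<in> {-1, 1}"
  shows "2 * ((5::int) ^ i - e * 5 ^ j) \<noteq> 2 * 5 ^ i - e * 5 ^ j"
  using assms by auto

end

(* Let Q be a nondegenerate diagonal quadratic form on F_5^n whose discriminant has quadratic
   character e, with polar form 2 D. The vertices are the pairs {z, -z} with Q(z) = 1. Distinct
   vertices satisfy D = 0, D = 1 or -1 (tangent line), or D = 2 or -2 (elliptic line), and G joins
   the pairs of the last kind. The number of z with Q(z) = 1, D(x, z) = s, D(y, z) = t is computed
   with additive characters: completing the square turns it into
   5^(n-3) + e 5^((n-5)/2) * (sum over b, c of chi(1 + 2bs + 2ct + Q(bx + cy))), where chi is the
   quadratic character, so it depends only on D(x, y). Summing over the admissible s and t, the number of
   common neighbours in G takes one value for D = 0 and another one for D <> 0; hence the children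
   are the graph D = 0 and its complement, and both are strongly regular by the same count. *)
theory Submission
  imports Defs Complex_Main "HOL-Library.FuncSet" "HOL-Computational_Algebra.Primes"
begin

section \<open>Additive characters and Gauss sums modulo 5\<close>

text \<open>Representatives closed under negation, so that negating a vector needs no reduction modulo 5.\<close>

definition residues5 :: "int set" where
  "residues5 = {-2, -1, 0, 1, 2}"

lemma residues5_simps [simp]: "finite residues5" "card residues5 = 5"
  by (simp_all add: residues5_def)

lemma residues5_uminus: "k \<in> residues5 \<Longrightarrow> - k \<in> residues5"
  by (auto simp: residues5_def)

lemma residues5_eq: "j \<in> residues5 \<Longrightarrow> k \<in> residues5 \<Longrightarrow> 5 dvd j - k \<Longrightarrow> j = k"
  by (auto simp: residues5_def)

lemma residues5_rep: "\<exists>r\<in>residues5. r mod 5 = k mod 5"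
proof -
  have "k mod 5 \<in> {0, 1, 2, 3, 4}"
    by simp presburger
  then show ?thesis
    by (auto simp: residues5_def)
qed

section \<open>Sums over a full system of residues modulo 5\<close>

definition periodic5 :: "(int \<Rightarrow> 'a) \<Rightarrow> bool" where
  "periodic5 f \<longleftrightarrow> (\<forall>j k. j mod 5 = k mod 5 \<longrightarrow> f j = f k)"

text \<open>The map \<open>h\<close> may leave \<open>residues5\<close>, so it is followed by a
  choice \<open>r\<close> of representatives. Injectivity modulo 5 makes \<open>r \<circ> h\<close>
  injective on a finite set mapped into itself, hence a permutation, and periodicity of
  \<open>f\<close> removes \<open>r\<close> again.\<close>

lemma sum_residues5_reindex:
  fixes f :: "int \<Rightarrow> 'a::comm_monoid_add"
  assumes "periodic5 f" and inj: "\<And>j k. 5 dvd h j - h k \<Longrightarrow> 5 dvd j - k"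
  shows "(\<Sum>z\<in>residues5. f (h z)) = (\<Sum>z\<in>residues5. f z)"
proof -
  obtain r where r: "\<And>k. r k \<in> residues5" "\<And>k. r k mod 5 = k mod 5"
    using residues5_rep by metis
  have "inj_on (r \<circ> h) residues5"
  proof (rule inj_onI)
    fix j k assume jk: "j \<in> residues5" "k \<in> residues5" "(r \<circ> h) j = (r \<circ> h) k"
    then have "h j mod 5 = h k mod 5"
      using r(2) by (metis comp_apply)
    then show "j = k"
      using inj residues5_eq jk by (metis mod_eq_dvd_iff)
  qed
  then have "bij_betw (r \<circ> h) residues5 residues5"
    using r(1) by (intro bij_betw_imageI endo_inj_surj) auto
  from sum.reindex_bij_betw[OF this, of f]
  have "(\<Sum>z\<in>residues5. f (r (h z))) = (\<Sum>z\<in>residues5. f z)"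
    by simp
  moreover have "f (r k) = f k" for k
    using assms(1) r(2)[of k] unfolding periodic5_def by blast
  ultimately show ?thesis
    by simp
qed

lemma sum_residues5_shift:
  fixes f :: "int \<Rightarrow> 'a::comm_monoid_add"
  assumes "periodic5 f"
  shows "(\<Sum>z\<in>residues5. f (z + u)) = (\<Sum>z\<in>residues5. f z)"
  using assms by (rule sum_residues5_reindex) simp

lemma sum_residues5_scale:
  fixes f :: "int \<Rightarrow> 'a::comm_monoid_add"
  assumes "periodic5 f" and "\<not> 5 dvd a"
  shows "(\<Sum>z\<in>residues5. f (a * z)) = (\<Sum>z\<in>residues5. f z)"
  using assms(1)
proof (rule sum_residues5_reindex)
  fix j k assume "5 dvd a * j - a * k"
  then have "5 dvd a * (j - k)"
    by (simp add: algebra_simps)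
  moreover have "prime (5::int)"
    by simp
  ultimately show "5 dvd j - k"
    using assms(2) by (simp add: prime_dvd_mult_iff)
qed

section \<open>The Legendre symbol modulo 5 and the additive character of Z/5Z\<close>

definition chi5 :: "int \<Rightarrow> int" where
  "chi5 k = (if k mod 5 = 0 then 0 else if k mod 5 = 1 \<or> k mod 5 = 4 then 1 else -1)"

definition e5 :: "int \<Rightarrow> complex" where
  "e5 k = cis (2 * pi * of_int k / 5)"

lemma e5_add: "e5 (j + k) = e5 j * e5 k"
  by (simp add: e5_def cis_mult ring_distribs add_divide_distrib)

lemma e5_0 [simp]: "e5 0 = 1"
  by (simp add: e5_def)

lemma e5_mod: "j mod 5 = k mod 5 \<Longrightarrow> e5 j = e5 k"
proof -
  assume "j mod 5 = k mod 5"
  then obtain d where d: "j - k = 5 * d"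
    by (metis dvd_def mod_eq_dvd_iff)
  have "2 * pi * of_int (5 * d) / 5 = 2 * pi * of_int d"
    by simp
  then have "e5 (5 * d) = 1"
    unfolding e5_def by (simp only: cis_multiple_2pi Ints_of_int)
  moreover have "j = k + 5 * d"
    using d by simp
  ultimately show "e5 j = e5 k"
    by (simp add: e5_add)
qed

lemma periodic5_e5: "periodic5 e5"
  unfolding periodic5_def using e5_mod by blast

lemma e5_sum: "e5 (sum f A) = (\<Prod>i\<in>A. e5 (f i))"
  by (induction A rule: infinite_finite_induct) (simp_all add: e5_add)

text \<open>Shifting the summation variable by 1 multiplies the sum by \<open>e5 1\<close>, which
  differs from 1.\<close>

lemma sum_e5_residues: "(\<Sum>a\<in>residues5. e5 a) = 0"
proof -
  let ?s = "\<Sum>a\<in>residues5. e5 a"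
  from sum_residues5_shift[OF periodic5_e5, of 1]
  have "?s * e5 1 = ?s"
    unfolding e5_add sum_distrib_right .
  moreover have "e5 1 \<noteq> 1"
  proof
    assume "e5 1 = 1"
    then have "cos (2 * pi / 5) = 1"
      by (simp add: e5_def complex_eq_iff)
    moreover have "cos (2 * pi / 5) < cos 0"
      by (rule cos_monotone_0_pi) (auto simp: field_simps)
    ultimately show False
      by simp
  qed
  ultimately show ?thesis
    by simp
qed

text \<open>Orthogonality of characters: this is the device that turns a congruence modulo 5 into an
  exponential sum.\<close>

lemma sum_e5_mult:
  "(\<Sum>a\<in>residues5. e5 (k * a)) = (if 5 dvd k then 5 else 0)"
proof (cases "5 dvd k")
  case True
  then have "e5 (k * a) = e5 0" for a
    by (intro e5_mod) auto
  with True show ?thesis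
    by simp
next
  case False
  from sum_residues5_scale[OF periodic5_e5 False] False show ?thesis
    by (simp add: sum_e5_residues)
qed

section \<open>The quadratic Gauss sum\<close>

definition gauss5 :: complex where
  "gauss5 = (\<Sum>z\<in>residues5. e5 (z * z))"

lemma e5_sum_zero: "e5 (-2) + e5 (-1) + 1 + e5 1 + e5 2 = 0"
  using sum_e5_residues by (simp add: residues5_def add_ac)

text \<open>The nonzero squares 1 and -1 are each hit twice. Subtracting the vanishing sum of all
  values of \<open>e5\<close> leaves each term with its sign under \<open>chi5\<close>.\<close>

lemma gauss5_eq: "gauss5 = e5 1 + e5 (-1) - e5 2 - e5 (-2)"
proof -
  have "e5 4 = e5 (-1)"
    by (rule e5_mod) simp
  then have "gauss5 = 1 + 2 * e5 1 + 2 * e5 (-1)"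
    by (simp add: gauss5_def residues5_def)
  with e5_sum_zero show ?thesis
    by algebra
qed

text \<open>The counts below contain \<open>gauss5\<close> to the power \<open>Suc n\<close>, which
  is even for odd \<open>n\<close>, so this value evaluates it.\<close>

lemma gauss5_square: "gauss5 * gauss5 = 5"
proof -
  \<comment> \<open>Everything becomes a polynomial in one fifth root of unity; the exponents -2 and
    -1 are read as 3 and 4. The identity then follows from the fifth power being 1 and the five
    powers adding up to 0.\<close>
  define x where "x = e5 1"
  have x2: "e5 2 = x * x" "e5 (-2) = x * x * x" "e5 (-1) = x * x * x * x" "x * x * x * x * x = 1"
    unfolding x_def e5_add[symmetric] e5_0[symmetric] by (rule e5_mod; simp)+
  have "x * x * x + x * x * x * x + 1 + x + x * x = 0"
    using e5_sum_zero unfolding x2 x_def[symmetric] .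
  moreover have "gauss5 = x + x * x * x * x - x * x - x * x * x"
    unfolding gauss5_eq x2 x_def[symmetric] ..
  ultimately show ?thesis
    using x2(4) by algebra
qed

lemma chi5_mod: "j mod 5 = k mod 5 \<Longrightarrow> chi5 j = chi5 k"
  by (simp only: chi5_def)

lemma mod5_cases:
  fixes k :: int
  obtains "k mod 5 = 0" | "k mod 5 = 1" | "k mod 5 = 2" | "k mod 5 = 3" | "k mod 5 = 4"
proof -
  have "k mod 5 = 0 \<or> k mod 5 = 1 \<or> k mod 5 = 2 \<or> k mod 5 = 3 \<or> k mod 5 = 4"
    by presburger
  then show thesis
    by (elim disjE) (erule that)+
qed

lemma chi5_mult: "chi5 (j * k) = chi5 j * chi5 k"
proof -
  have *: "chi5 (j * k) = chi5 ((j mod 5) * (k mod 5))" "chi5 j = chi5 (j mod 5)" "chi5 k = chi5 (k mod 5)"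
    by (rule chi5_mod; simp add: mod_mult_eq)+
  show ?thesis
    unfolding * by (cases j rule: mod5_cases; cases k rule: mod5_cases; simp only:; simp add: chi5_def)
qed

text \<open>A square \<open>a\<close> permutes the nonzero squares, while a nonsquare exchanges them
  with the nonsquares, which reverses the sign in \<open>gauss5_eq\<close>.\<close>

lemma sum_e5_square:
  assumes "\<not> 5 dvd a"
  shows "(\<Sum>z\<in>residues5. e5 (a * (z * z))) = of_int (chi5 a) * gauss5"
proof -
  have r: "e5 (a * k) = e5 ((a mod 5) * k)" for k
    by (rule e5_mod) (simp add: mod_mult_left_eq)
  have g: "e5 (-2) = - (e5 (-1) + 1 + e5 1 + e5 2)"
    using e5_sum_zero by algebra
  have *: "e5 4 = e5 (-1)" "e5 3 = e5 (-2)" "e5 8 = e5 (-2)" "e5 12 = e5 2" "e5 16 = e5 1"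
    by (rule e5_mod; simp)+
  have c: "chi5 a = chi5 (a mod 5)"
    by (rule chi5_mod) simp
  have "a mod 5 = 1 \<or> a mod 5 = 2 \<or> a mod 5 = 3 \<or> a mod 5 = 4"
    using assms by presburger
  then show ?thesis
    unfolding r c by (elim disjE; simp only:; simp add: chi5_def residues5_def gauss5_eq * g)
qed

text \<open>Up to the factor \<open>gauss5\<close>, the character \<open>chi5\<close> is its own
  Fourier transform. This converts exponentials back into integer character values once the square
  has been completed.\<close>

lemma sum_chi5_e5:
  "(\<Sum>a\<in>residues5. of_int (chi5 a) * e5 (a * k)) = of_int (chi5 k) * gauss5"
proof -
  have r: "e5 (a * k) = e5 (a * (k mod 5))" for a
    by (rule e5_mod) (simp add: mod_mult_right_eq)
  have *: "e5 4 = e5 (-1)" "e5 3 = e5 (-2)" "e5 6 = e5 1" "e5 8 = e5 (-2)" "e5 (-3) = e5 2" "e5 (-4) = e5 1" "e5 (-6) = e5 (-1)" "e5 (-8) = e5 2"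
    by (rule e5_mod; simp)+
  have c: "chi5 0 = 0" "chi5 1 = 1" "chi5 2 = -1" "chi5 (-1) = 1" "chi5 (-2) = -1"
    by (simp_all add: chi5_def)
  show ?thesis
    unfolding r by (cases k rule: mod5_cases; simp only:; simp add: residues5_def gauss5_eq * c; simp add: chi5_def)
qed

text \<open>Completing the square; the linear term carries a factor 2, so the shift by
  \<open>u\<close> is integral.\<close>

lemma sum_e5_quadratic:
  assumes "\<not> 5 dvd a"
  shows "(\<Sum>z\<in>residues5. e5 (a * (z * z + 2 * (u * z)))) = of_int (chi5 a) * gauss5 * e5 (- (a * (u * u)))"
proof -
  have "e5 (a * (z * z + 2 * (u * z))) = e5 (a * ((z + u) * (z + u))) * e5 (- (a * (u * u)))" for z
    by (simp add: algebra_simps flip: e5_add)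
  then have "(\<Sum>z\<in>residues5. e5 (a * (z * z + 2 * (u * z))))
    = (\<Sum>z\<in>residues5. e5 (a * ((z + u) * (z + u)))) * e5 (- (a * (u * u)))"
    by (simp only: sum_distrib_right)
  also have "(\<Sum>z\<in>residues5. e5 (a * ((z + u) * (z + u)))) = (\<Sum>z\<in>residues5. e5 (a * (z * z)))"
    by (rule sum_residues5_shift) (auto simp: periodic5_def intro!: e5_mod mod_mult_cong)
  finally show ?thesis
    by (simp add: sum_e5_square[OF assms])
qed

section \<open>Counting points on a quadric over the field with 5 elements\<close>

locale diagonal_form =
  fixes n :: nat and w :: "nat \<Rightarrow> int"
  assumes weight: "\<And>i. i < n \<Longrightarrow> \<not> 5 dvd w i"
begin

text \<open>A model of the vector space of dimension \<open>n\<close> over F_5: entries are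
  canonical representatives and the value outside the index range is fixed to
  \<open>undefined\<close>, so vectors congruent modulo 5 are equal functions.\<close>

definition vecs :: "(nat \<Rightarrow> int) set" where
  "vecs = (\<Pi>\<^sub>E i\<in>{..<n}. residues5)"

text \<open>Integer valued, so that bilinearity holds as an exact identity; reduction modulo 5 takes
  place only where values are compared.\<close>

definition form :: "(nat \<Rightarrow> int) \<Rightarrow> (nat \<Rightarrow> int) \<Rightarrow> int" where
  "form x y = (\<Sum>i<n. w i * (x i * y i))"

text \<open>The quadratic character of the discriminant, not the discriminant itself.\<close>

definition disc :: int where
  "disc = (\<Prod>i<n. chi5 (w i))"

lemma finite_vecs [simp]: "finite vecs"
  by (auto simp: vecs_def intro!: finite_PiE)

lemma form_commute: "form x y = form y x"
  by (simp add: form_def mult.commute)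

lemma form_add_left: "form (\<lambda>i. x i + y i) z = form x z + form y z"
  by (simp add: form_def algebra_simps sum.distrib)

lemma form_scale_left: "form (\<lambda>i. c * x i) z = c * form x z"
  by (simp add: form_def algebra_simps sum_distrib_left)

lemma form_zero_left [simp]: "form (\<lambda>i. 0) z = 0"
  by (simp add: form_def)

lemma form_combination_left:
  "form (\<lambda>i. b * x i + c * y i) z = b * form x z + c * form y z"
  by (simp add: form_add_left form_scale_left)

lemma form_combination:
  "form (\<lambda>i. b * x i + c * y i) (\<lambda>i. b * x i + c * y i)
    = b * b * form x x + c * c * form y y + 2 * (b * c) * form x y"
proof -
  have "form x (\<lambda>i. b * x i + c * y i) = b * form x x + c * form x y"
    "form y (\<lambda>i. b * x i + c * y i) = b * form x y + c * form y y"
    by (metis form_combination_left form_commute)+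
  then show ?thesis
    by (simp add: form_combination_left algebra_simps)
qed

lemma form_cong_mod:
  assumes "\<And>i. i < n \<Longrightarrow> 5 dvd x i - y i"
  shows "5 dvd form x z - form y z"
proof -
  have "form x z - form y z = (\<Sum>i<n. w i * ((x i - y i) * z i))"
    by (simp add: form_def algebra_simps sum_subtractf)
  also have "5 dvd \<dots>"
    using assms by (intro dvd_sum) auto
  finally show ?thesis .
qed

text \<open>Since the form is diagonal, the sum factors into one-variable sums, each given by
  \<open>sum_e5_quadratic\<close> with the unit \<open>a * w i\<close>. The characters of the
  weights multiply up to \<open>disc\<close>.\<close>

lemma sum_vecs_quadratic:
  assumes "\<not> 5 dvd a"
  shows "(\<Sum>z\<in>vecs. e5 (a * (form z z + 2 * form u z)))
    = of_int (chi5 a ^ n * disc) * gauss5 ^ n * e5 (- (a * form u u))"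
proof -
  have prime5: "prime (5::int)"
    by simp
  have "e5 (a * (form z z + 2 * form u z)) = (\<Prod>i<n. e5 (a * w i * (z i * z i + 2 * (u i * z i))))" for z
    unfolding form_def e5_sum[symmetric]
    by (rule arg_cong[of _ _ e5]) (simp add: algebra_simps sum_distrib_left sum.distrib)
  then have "(\<Sum>z\<in>vecs. e5 (a * (form z z + 2 * form u z)))
    = (\<Prod>i<n. \<Sum>k\<in>residues5. e5 (a * w i * (k * k + 2 * (u i * k))))"
    by (simp add: vecs_def prod_sum_PiE)
  also have "\<dots> = (\<Prod>i<n. of_int (chi5 a) * of_int (chi5 (w i)) * gauss5 * e5 (- (a * w i * (u i * u i))))"
  proof (rule prod.cong[OF refl])
    fix i assume "i \<in> {..<n}"
    then have "\<not> 5 dvd a * w i"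
      using assms weight prime5 by (simp add: prime_dvd_mult_iff)
    from sum_e5_quadratic[OF this, of "u i"]
    show "(\<Sum>k\<in>residues5. e5 (a * w i * (k * k + 2 * (u i * k))))
      = of_int (chi5 a) * of_int (chi5 (w i)) * gauss5 * e5 (- (a * w i * (u i * u i)))"
      by (simp add: chi5_mult)
  qed
  also have "\<dots> = of_int (chi5 a ^ n * disc) * gauss5 ^ n * (\<Prod>i<n. e5 (- (a * w i * (u i * u i))))"
    by (simp add: prod.distrib disc_def)
  also have "(\<Prod>i<n. e5 (- (a * w i * (u i * u i)))) = e5 (- (a * form u u))"
    unfolding form_def e5_sum[symmetric]
    by (rule arg_cong[of _ _ e5]) (simp add: sum_distrib_left sum_negf mult.assoc)
  finally show ?thesis .
qed

text \<open>The counterpart without quadratic term: by orthogonality every coordinate factor is 5 or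
  0, and the weights are units, so it is 5 exactly when that coordinate of \<open>u\<close> vanishes
  modulo 5.\<close>

lemma sum_vecs_linear:
  "(\<Sum>z\<in>vecs. e5 (2 * form u z)) = (if \<forall>i<n. 5 dvd u i then 5 ^ n else 0)"
proof -
  have prime5: "prime (5::int)"
    by simp
  have "e5 (2 * form u z) = (\<Prod>i<n. e5 (2 * w i * u i * z i))" for z
    unfolding form_def e5_sum[symmetric]
    by (rule arg_cong[of _ _ e5]) (simp add: algebra_simps sum_distrib_left)
  then have "(\<Sum>z\<in>vecs. e5 (2 * form u z)) = (\<Prod>i<n. \<Sum>k\<in>residues5. e5 (2 * w i * u i * k))"
    by (simp add: vecs_def prod_sum_PiE)
  also have "\<dots> = (\<Prod>i<n. if 5 dvd u i then 5 else 0)"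
  proof (rule prod.cong[OF refl])
    fix i assume "i \<in> {..<n}"
    then have "5 dvd 2 * w i * u i \<longleftrightarrow> 5 dvd u i"
      using weight[of i] prime5 by (simp add: prime_dvd_mult_iff)
    then show "(\<Sum>k\<in>residues5. e5 (2 * w i * u i * k)) = (if 5 dvd u i then 5 else 0)"
      unfolding sum_e5_mult by simp
  qed
  also have "\<dots> = (if \<forall>i<n. 5 dvd u i then 5 ^ n else 0)"
    by auto
  finally show ?thesis .
qed

section \<open>Sphere points with two prescribed values of the bilinear form\<close>

definition sphere :: "(nat \<Rightarrow> int) set" where
  "sphere = {z \<in> vecs. form z z mod 5 = 1}"

lemma finite_sphere [simp]: "finite sphere"
  by (simp add: sphere_def)

text \<open>Three congruences, each detected by a character sum, account for the factor 125. The
  variable \<open>a\<close> belongs to the sphere equation: \<open>a = 0\<close> leaves linear sums,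
  which see only the linear relations between \<open>x\<close> and \<open>y\<close>, and every other
  \<open>a\<close> leaves a Gauss sum.\<close>

lemma count_sphere_slice:
  assumes "odd n" and st: "s \<in> {0..4}" "t \<in> {0..4}"
  shows "125 * of_nat (card {z \<in> sphere. form x z mod 5 = s \<and> form y z mod 5 = t})
    = (\<Sum>b\<in>residues5. \<Sum>c\<in>residues5. e5 (- (2 * (b * s + c * t))) *
        (if \<forall>i<n. 5 dvd b * x i + c * y i then 5 ^ n else 0))
      + of_int disc * gauss5 ^ Suc n * of_int (\<Sum>b\<in>residues5. \<Sum>c\<in>residues5.
        chi5 (1 + 2 * (b * s) + 2 * (c * t) + b * b * form x x + c * c * form y y + 2 * (b * c) * form x y))"
    (is "125 * of_nat (card ?A) = _")
proof -
  define E where "E a b c = (\<Sum>z\<in>vecs. e5 (a * (form z z - 1) + 2 * b * (form x z - s) + 2 * c * (form y z - t)))" for a b c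
  define u where "u b c = (\<lambda>i. b * x i + c * y i)" for b c
  define P where "P b c = 1 + 2 * (b * s) + 2 * (c * t) + form (u b c) (u b c)" for b c
  have "125 * of_nat (card ?A) = (\<Sum>z\<in>?A. 125 :: complex)"
    by simp
  also have "\<dots> = (\<Sum>z\<in>vecs. if z \<in> ?A then 125 else 0)"
    by (rule sum.mono_neutral_cong_left) (auto simp: sphere_def)
  \<comment> \<open>Each inner sum is 5 or 0. The factor 2 is a unit modulo 5, so it does not alter
    the conditions, and it prepares the linear terms for completing the square.\<close>
  also have "\<dots> = (\<Sum>z\<in>vecs. (\<Sum>c\<in>residues5. e5 (2 * (form y z - t) * c)) *
      (\<Sum>b\<in>residues5. e5 (2 * (form x z - s) * b)) * (\<Sum>a\<in>residues5. e5 ((form z z - 1) * a)))"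
  proof (rule sum.cong[OF refl])
    fix z assume "z \<in> vecs"
    moreover have "5 dvd form z z - 1 \<longleftrightarrow> form z z mod 5 = 1"
      by (simp flip: mod_eq_dvd_iff)
    moreover have "5 dvd 2 * (k - r) \<longleftrightarrow> k mod 5 = r" if "r \<in> {0..4}" for k r :: int
    proof -
      have "5 dvd 2 * (k - r) \<longleftrightarrow> 5 dvd k - r"
        by presburger
      also have "\<dots> \<longleftrightarrow> k mod 5 = r"
        using that by (simp flip: mod_eq_dvd_iff)
      finally show ?thesis .
    qed
    ultimately show "(if z \<in> ?A then 125 else 0) = (\<Sum>c\<in>residues5. e5 (2 * (form y z - t) * c)) *
      (\<Sum>b\<in>residues5. e5 (2 * (form x z - s) * b)) * (\<Sum>a\<in>residues5. e5 ((form z z - 1) * a))"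
      using st unfolding sum_e5_mult by (simp add: sphere_def)
  qed
  also have "\<dots> = (\<Sum>z\<in>vecs. \<Sum>a\<in>residues5. \<Sum>b\<in>residues5. \<Sum>c\<in>residues5.
      e5 (a * (form z z - 1) + 2 * b * (form x z - s) + 2 * c * (form y z - t)))"
    unfolding sum_distrib_left sum_distrib_right e5_add[symmetric]
    by (intro sum.cong refl arg_cong[of _ _ e5]) (simp add: algebra_simps)
  also have "\<dots> = (\<Sum>a\<in>residues5. \<Sum>b\<in>residues5. \<Sum>c\<in>residues5. E a b c)"
    unfolding E_def by (simp add: sum.swap[of _ _ vecs])
  also have "\<dots> = (\<Sum>b\<in>residues5. \<Sum>c\<in>residues5. E 0 b c)
      + (\<Sum>a\<in>residues5 - {0}. \<Sum>b\<in>residues5. \<Sum>c\<in>residues5. E a b c)"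
    by (rule sum.remove) (auto simp: residues5_def)
  also have "(\<Sum>b\<in>residues5. \<Sum>c\<in>residues5. E 0 b c) = (\<Sum>b\<in>residues5. \<Sum>c\<in>residues5.
      e5 (- (2 * (b * s + c * t))) * (if \<forall>i<n. 5 dvd b * x i + c * y i then 5 ^ n else 0))"
  proof (intro sum.cong refl)
    fix b c
    have "E 0 b c = (\<Sum>z\<in>vecs. e5 (- (2 * (b * s + c * t))) * e5 (2 * form (u b c) z))"
      unfolding E_def e5_add[symmetric] u_def form_combination_left
      by (intro sum.cong refl arg_cong[of _ _ e5]) (simp add: algebra_simps)
    also have "\<dots> = e5 (- (2 * (b * s + c * t))) * (if \<forall>i<n. 5 dvd b * x i + c * y i then 5 ^ n else 0)"
      unfolding sum_distrib_left[symmetric] sum_vecs_linear by (simp add: u_def)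
    finally show "E 0 b c = e5 (- (2 * (b * s + c * t))) * (if \<forall>i<n. 5 dvd b * x i + c * y i then 5 ^ n else 0)" .
  qed
  \<comment> \<open>For \<open>a \<noteq> 0\<close>, replacing \<open>b, c\<close> by \<open>a b, a c\<close> avoids dividing by \<open>a\<close> when the square is completed.\<close>
  also have "(\<Sum>a\<in>residues5 - {0}. \<Sum>b\<in>residues5. \<Sum>c\<in>residues5. E a b c)
      = (\<Sum>a\<in>residues5 - {0}. \<Sum>b\<in>residues5. \<Sum>c\<in>residues5.
          of_int disc * gauss5 ^ n * (of_int (chi5 a) * e5 (a * - P b c)))"
  proof (rule sum.cong[OF refl])
    fix a assume "a \<in> residues5 - {0}"
    then have a: "\<not> 5 dvd a" and "chi5 a \<in> {-1, 1}"
      by (auto simp: residues5_def chi5_def)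
    \<comment> \<open>Odd \<open>n\<close> preserves the character, so that the sum over
      \<open>a\<close> becomes the Fourier transform of \<open>chi5\<close>.\<close>
    then have "chi5 a ^ n = chi5 a"
      using \<open>odd n\<close> by auto
    have "E a (a * b) (a * c) = of_int disc * gauss5 ^ n * (of_int (chi5 a) * e5 (a * - P b c))" for b c
    proof -
      have "E a (a * b) (a * c) = (\<Sum>z\<in>vecs. e5 (- (a * (1 + 2 * (b * s) + 2 * (c * t)))) * e5 (a * (form z z + 2 * form (u b c) z)))"
        unfolding E_def e5_add[symmetric] u_def form_combination_left
        by (intro sum.cong refl arg_cong[of _ _ e5]) (simp add: algebra_simps)
      also have "\<dots> = of_int disc * gauss5 ^ n * (of_int (chi5 a) *
          (e5 (- (a * (1 + 2 * (b * s) + 2 * (c * t)))) * e5 (- (a * form (u b c) (u b c)))))"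
        unfolding sum_distrib_left[symmetric] sum_vecs_quadratic[OF a] \<open>chi5 a ^ n = chi5 a\<close> by simp
      also have "e5 (- (a * (1 + 2 * (b * s) + 2 * (c * t)))) * e5 (- (a * form (u b c) (u b c))) = e5 (a * - P b c)"
        unfolding e5_add[symmetric] P_def by (simp add: algebra_simps)
      finally show ?thesis .
    qed
    moreover have "(\<Sum>b\<in>residues5. \<Sum>c\<in>residues5. E a b c)
      = (\<Sum>b\<in>residues5. \<Sum>c\<in>residues5. E a (a * b) (a * c))"
    proof -
      have mod_E: "E a b c = E a b' c'" if bc: "b mod 5 = b' mod 5" "c mod 5 = c' mod 5" for b b' c c'
        unfolding E_def
      proof (intro sum.cong refl e5_mod)
        fix z
        have "2 * b * (form x z - s) mod 5 = 2 * b' * (form x z - s) mod 5"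
          "2 * c * (form y z - t) mod 5 = 2 * c' * (form y z - t) mod 5"
          by (intro mod_mult_cong bc refl)+
        then show "(a * (form z z - 1) + 2 * b * (form x z - s) + 2 * c * (form y z - t)) mod 5 =
          (a * (form z z - 1) + 2 * b' * (form x z - s) + 2 * c' * (form y z - t)) mod 5"
          by (intro mod_add_cong refl)
      qed
      have "(\<Sum>b\<in>residues5. \<Sum>c\<in>residues5. E a (a * b) (a * c)) = (\<Sum>b\<in>residues5. \<Sum>c\<in>residues5. E a (a * b) c)"
        by (intro sum.cong refl sum_residues5_scale[OF _ a]) (auto simp only: periodic5_def intro!: mod_E)
      also have "\<dots> = (\<Sum>b\<in>residues5. \<Sum>c\<in>residues5. E a b c)"
        by (rule sum_residues5_scale[OF _ a]) (auto simp only: periodic5_def intro!: mod_E sum.cong)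
      finally show ?thesis ..
    qed
    ultimately show "(\<Sum>b\<in>residues5. \<Sum>c\<in>residues5. E a b c)
      = (\<Sum>b\<in>residues5. \<Sum>c\<in>residues5. of_int disc * gauss5 ^ n * (of_int (chi5 a) * e5 (a * - P b c)))"
      by simp
  qed
  \<comment> \<open>The term \<open>a = 0\<close> can be restored because
    \<open>chi5 0 = 0\<close>.\<close>
  also have "\<dots> = (\<Sum>a\<in>residues5. \<Sum>b\<in>residues5. \<Sum>c\<in>residues5.
          of_int disc * gauss5 ^ n * (of_int (chi5 a) * e5 (a * - P b c)))"
    by (rule sum.mono_neutral_left) (auto simp: chi5_def)
  also have "\<dots> = (\<Sum>b\<in>residues5. \<Sum>c\<in>residues5. \<Sum>a\<in>residues5.
          of_int disc * gauss5 ^ n * (of_int (chi5 a) * e5 (a * - P b c)))"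
    by (subst sum.swap, intro sum.cong refl sum.swap)
  also have "\<dots> = (\<Sum>b\<in>residues5. \<Sum>c\<in>residues5. of_int disc * gauss5 ^ Suc n * of_int (chi5 (P b c)))"
  proof (intro sum.cong refl)
    fix b c
    \<comment> \<open>As -1 is a square modulo 5, the sign left over from completing the square
      disappears.\<close>
    have "chi5 (- P b c) = chi5 (-1) * chi5 (P b c)"
      by (simp flip: chi5_mult)
    also have "chi5 (-1) = 1"
      by (simp add: chi5_def)
    finally show "(\<Sum>a\<in>residues5. of_int disc * gauss5 ^ n * (of_int (chi5 a) * e5 (a * - P b c)))
      = of_int disc * gauss5 ^ Suc n * of_int (chi5 (P b c))"
      unfolding sum_distrib_left[symmetric] sum_chi5_e5 by simp
  qed
  also have "\<dots> = of_int disc * gauss5 ^ Suc n * of_int (\<Sum>b\<in>residues5. \<Sum>c\<in>residues5. chi5 (P b c))"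
    by (simp only: of_int_sum sum_distrib_left)
  finally show ?thesis
    unfolding P_def u_def form_combination by (simp only: add.assoc)
qed

end

section \<open>The character sum for two points of the sphere\<close>

text \<open>The case \<open>form x x = form y y = 1\<close>, \<open>form x y = d\<close> of the sum in \<open>count_sphere_slice\<close>.\<close>

definition slice_sum :: "int \<Rightarrow> int \<Rightarrow> int \<Rightarrow> int" where
  "slice_sum d s t = (\<Sum>b\<in>residues5. \<Sum>c\<in>residues5.
    chi5 (1 + 2 * (b * s) + 2 * (c * t) + b * b + c * c + 2 * (b * c) * d))"

lemma slice_sum_mod: "slice_sum (d mod 5) = slice_sum d"
  unfolding slice_sum_def
  by (intro ext sum.cong refl chi5_mod mod_add_cong) (simp add: mod_mult_right_eq)

text \<open>The three lines serve the relations D = 0, D = 2 or -2 (adjacency in the Deza graph),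
  and D <> 0. Only \<open>d mod 5\<close> matters, so five evaluations settle each line. That
  \<open>d = 0\<close> is the only value set apart is what makes the graph a Deza graph with
  strongly regular children.\<close>

lemma slice_sum_table:
  "slice_sum d 0 0 = (if d mod 5 = 0 then 5 else -5)"
  "(\<Sum>s\<in>{2, 3}. \<Sum>t\<in>{2, 3}. slice_sum d s t) = (if d mod 5 = 0 then -20 else -10)"
  "(\<Sum>s\<in>{1, 2, 3, 4}. \<Sum>t\<in>{1, 2, 3, 4}. slice_sum d s t) = (if d mod 5 = 0 then 40 else 30)"
proof -
  let ?P = "\<lambda>d. slice_sum d 0 0 = (if d = 0 then 5 else -5) \<and>
    (\<Sum>s\<in>{2, 3}. \<Sum>t\<in>{2, 3}. slice_sum d s t) = (if d = 0 then -20 else -10) \<and>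
    (\<Sum>s\<in>{1, 2, 3, 4}. \<Sum>t\<in>{1, 2, 3, 4}. slice_sum d s t) = (if d = 0 then 40 else 30)"
  have "?P 0" "?P 1" "?P 2" "?P 3" "?P 4"
    by code_simp+
  then have P: "?P (d mod 5)"
    by (cases d rule: mod5_cases) (simp_all only:)
  show "slice_sum d 0 0 = (if d mod 5 = 0 then 5 else -5)"
    using P unfolding slice_sum_mod by (rule conjunct1)
  show "(\<Sum>s\<in>{2, 3}. \<Sum>t\<in>{2, 3}. slice_sum d s t) = (if d mod 5 = 0 then -20 else -10)"
    using P unfolding slice_sum_mod by (rule conjunct2[THEN conjunct1])
  show "(\<Sum>s\<in>{1, 2, 3, 4}. \<Sum>t\<in>{1, 2, 3, 4}. slice_sum d s t) = (if d mod 5 = 0 then 40 else 30)"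
    using P unfolding slice_sum_mod by (rule conjunct2[THEN conjunct2])
qed

section \<open>Cardinalities on the sphere\<close>

lemma card_slices:
  assumes "finite A" "finite S" "finite T"
  shows "card {z \<in> A. f z \<in> S \<and> g z \<in> T} = (\<Sum>s\<in>S. \<Sum>t\<in>T. card {z \<in> A. f z = s \<and> g z = t})"
proof -
  have "{z \<in> A. f z \<in> S \<and> g z \<in> T} = (\<Union>(s, t)\<in>S \<times> T. {z \<in> A. f z = s \<and> g z = t})"
    by auto
  also have "card \<dots> = (\<Sum>(s, t)\<in>S \<times> T. card {z \<in> A. f z = s \<and> g z = t})"
    using assms by (subst card_UN_disjoint) (auto intro!: sum.cong)
  finally show ?thesis
    by (simp add: sum.cartesian_product)
qed

lemma gauss5_power: "gauss5 ^ Suc (2 * m + 5) = 125 * 5 ^ m"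
proof -
  have "gauss5 ^ Suc (2 * m + 5) = (gauss5 * gauss5) ^ (m + 3)"
    unfolding power_mult_distrib power_add[symmetric] by (rule arg_cong) simp
  then show ?thesis
    by (simp add: gauss5_square power_add)
qed

context diagonal_form
begin

text \<open>\<open>S\<close> is a set of residues between 0 and 4, so D = 2 or -2 is expressed by
  \<open>{2, 3}\<close>.\<close>

definition in_rel :: "int set \<Rightarrow> (nat \<Rightarrow> int) \<Rightarrow> (nat \<Rightarrow> int) \<Rightarrow> bool" where
  "in_rel S x z \<longleftrightarrow> form x z mod 5 \<in> S"

text \<open>\<open>L\<close> stands for the contribution of the linear relations between
  \<open>x\<close> and \<open>y\<close>; it will be 25, 5 or 1 as the two vectors have rank 0, 1 or
  2. Division by 125 leaves \<open>25 * 5 ^ m * 5 ^ m\<close> of \<open>5 ^ n\<close> and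
  \<open>5 ^ m\<close> of \<open>gauss5 ^ Suc n\<close>.\<close>

lemma count_sphere_slice_int:
  assumes n: "n = 2 * m + 5" and st: "s \<in> {0..4}" "t \<in> {0..4}"
    and L: "(\<Sum>b\<in>residues5. \<Sum>c\<in>residues5. e5 (- (2 * (b * s + c * t))) *
        (if \<forall>i<n. 5 dvd b * x i + c * y i then 5 ^ n else 0)) = of_int L * 5 ^ n"
  shows "int (card {z \<in> sphere. form x z mod 5 = s \<and> form y z mod 5 = t})
    = 25 * 5 ^ m * 5 ^ m * L + disc * 5 ^ m * (\<Sum>b\<in>residues5. \<Sum>c\<in>residues5.
        chi5 (1 + 2 * (b * s) + 2 * (c * t) + b * b * form x x + c * c * form y y + 2 * (b * c) * form x y))"
    (is "int ?N = _ + _ * ?S")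
proof -
  define N where "N = ?N"
  define S where "S = ?S"
  have "odd n"
    using n by simp
  have "125 * of_nat N = of_int L * 5 ^ n + of_int disc * gauss5 ^ Suc n * of_int S"
    using count_sphere_slice[OF \<open>odd n\<close> st, of x y] unfolding L N_def S_def .
  moreover have "gauss5 ^ Suc n = 125 * 5 ^ m"
    using gauss5_power[of m] by (simp only: n)
  moreover have "(5::complex) ^ n = 3125 * 5 ^ m * 5 ^ m"
    unfolding n power_add mult_2 by simp
  ultimately have "of_int (125 * int N) = (of_int (125 * (25 * 5 ^ m * 5 ^ m * L + disc * 5 ^ m * S)) :: complex)"
    by (simp add: algebra_simps)
  then have "125 * int N = 125 * (25 * 5 ^ m * 5 ^ m * L + disc * 5 ^ m * S)"
    by (simp only: of_int_eq_iff)
  then have "int N = 25 * 5 ^ m * 5 ^ m * L + disc * 5 ^ m * S"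
    by simp
  then show ?thesis
    unfolding N_def S_def .
qed

lemma card_sphere:
  assumes n: "n = 2 * m + 5"
  shows "int (card sphere) = 625 * 5 ^ m * 5 ^ m + 25 * disc * 5 ^ m"
proof -
  \<comment> \<open>For two zero vectors the conditions are vacuous, so the slice is the whole
    sphere, and all 25 pairs of coefficients are relations.\<close>
  have "int (card {z \<in> sphere. form (\<lambda>i. 0) z mod 5 = 0 \<and> form (\<lambda>i. 0) z mod 5 = 0})
    = 25 * 5 ^ m * 5 ^ m * 25 + disc * 5 ^ m * (\<Sum>b\<in>residues5. \<Sum>c\<in>residues5.
        chi5 (1 + 2 * (b * 0) + 2 * (c * 0) + b * b * form (\<lambda>i. 0) (\<lambda>i. 0) + c * c * form (\<lambda>i. 0) (\<lambda>i. 0)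
          + 2 * (b * c) * form (\<lambda>i. 0) (\<lambda>i. 0)))"
    by (rule count_sphere_slice_int[OF n]) simp_all
  then show ?thesis
    by (simp add: chi5_def)
qed

text \<open>The second vector is taken to be zero: the relations are \<open>b = 0\<close> with
  \<open>c\<close> arbitrary, so \<open>L\<close> is 5, and the free sum over \<open>c\<close>
  yields the factor 5 in the other term.\<close>

lemma card_sphere_slice:
  assumes n: "n = 2 * m + 5" and x: "x \<in> sphere" and s: "s \<in> {0..4}"
  shows "int (card {z \<in> sphere. form x z mod 5 = s})
    = 125 * 5 ^ m * 5 ^ m + 5 * disc * 5 ^ m * (\<Sum>b\<in>residues5. chi5 (1 + 2 * (b * s) + b * b))"
proof -
  have form_x: "form x x mod 5 = 1"
    using x by (simp add: sphere_def)
  \<comment> \<open>Pairing the relation with \<open>x\<close> gives \<open>b * form x x\<close>,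
    where \<open>form x x\<close> is a unit modulo 5.\<close>
  have iff: "(\<forall>i<n. 5 dvd b * x i) \<longleftrightarrow> b = 0" if "b \<in> residues5" for b
  proof
    assume "\<forall>i<n. 5 dvd b * x i"
    then have "5 dvd form (\<lambda>i. b * x i) x - form (\<lambda>i. 0) x"
      by (intro form_cong_mod) simp
    then have "5 dvd b * form x x"
      by (simp add: form_scale_left)
    moreover have "\<not> 5 dvd form x x"
      using form_x by presburger
    moreover have "prime (5::int)"
      by simp
    ultimately have "5 dvd b"
      using prime_dvd_mult_iff by blast
    with that show "b = 0"
      by (auto simp: residues5_def)
  qed simp
  have "int (card {z \<in> sphere. form x z mod 5 = s \<and> form (\<lambda>i. 0) z mod 5 = 0})
    = 25 * 5 ^ m * 5 ^ m * 5 + disc * 5 ^ m * (\<Sum>b\<in>residues5. \<Sum>c\<in>residues5.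
        chi5 (1 + 2 * (b * s) + 2 * (c * 0) + b * b * form x x + c * c * form (\<lambda>i. 0) (\<lambda>i. 0)
          + 2 * (b * c) * form x (\<lambda>i. 0)))"
  proof (rule count_sphere_slice_int[OF n s])
    have "(\<Sum>b\<in>residues5. \<Sum>c\<in>residues5. e5 (- (2 * (b * s + c * 0))) *
        (if \<forall>i<n. 5 dvd b * x i + c * 0 then 5 ^ n else 0))
      = (\<Sum>b\<in>residues5. if b = 0 then 5 * 5 ^ n else 0)"
      by (intro sum.cong refl) (simp add: iff)
    also have "\<dots> = of_int 5 * 5 ^ n"
      by (simp add: sum.delta residues5_def)
    finally show "(\<Sum>b\<in>residues5. \<Sum>c\<in>residues5. e5 (- (2 * (b * s + c * 0))) *
        (if \<forall>i<n. 5 dvd b * x i + c * 0 then 5 ^ n else 0)) = of_int 5 * 5 ^ n" .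
  qed simp
  also have "form x (\<lambda>i. 0) = 0"
    by (simp add: form_def)
  also have "(\<Sum>b\<in>residues5. \<Sum>c\<in>residues5.
        chi5 (1 + 2 * (b * s) + 2 * (c * 0) + b * b * form x x + c * c * form (\<lambda>i. 0) (\<lambda>i. 0)
          + 2 * (b * c) * 0)) = (\<Sum>b\<in>residues5. \<Sum>c\<in>residues5. chi5 (1 + 2 * (b * s) + b * b))"
  proof (intro sum.cong refl chi5_mod)
    fix b c :: int
    have "(1 + 2 * (b * s) + b * b * form x x) mod 5 = (1 + 2 * (b * s) + b * b * 1) mod 5"
      by (intro mod_add_cong[OF refl] mod_mult_cong[OF refl]) (simp add: form_x)
    then show "(1 + 2 * (b * s) + 2 * (c * 0) + b * b * form x x + c * c * form (\<lambda>i. 0) (\<lambda>i. 0)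
          + 2 * (b * c) * 0) mod 5 = (1 + 2 * (b * s) + b * b) mod 5"
      by simp
  qed
  finally show ?thesis
    by (simp add: sum_distrib_left algebra_simps)
qed

text \<open>Linear independence over F_5 of the reduced vectors.\<close>

definition independent :: "(nat \<Rightarrow> int) \<Rightarrow> (nat \<Rightarrow> int) \<Rightarrow> bool" where
  "independent x y \<longleftrightarrow> (\<forall>b\<in>residues5. \<forall>c\<in>residues5. (\<forall>i<n. 5 dvd b * x i + c * y i) \<longrightarrow> b = 0 \<and> c = 0)"

lemma card_sphere_slice2:
  assumes n: "n = 2 * m + 5" and x: "x \<in> sphere" and y: "y \<in> sphere" and ind: "independent x y"
    and st: "s \<in> {0..4}" "t \<in> {0..4}"
  shows "int (card {z \<in> sphere. form x z mod 5 = s \<and> form y z mod 5 = t})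
    = 25 * 5 ^ m * 5 ^ m + disc * 5 ^ m * slice_sum (form x y) s t"
proof -
  have form_xy: "form x x mod 5 = 1" "form y y mod 5 = 1"
    using x y by (simp_all add: sphere_def)
  have "int (card {z \<in> sphere. form x z mod 5 = s \<and> form y z mod 5 = t})
    = 25 * 5 ^ m * 5 ^ m * 1 + disc * 5 ^ m * (\<Sum>b\<in>residues5. \<Sum>c\<in>residues5.
        chi5 (1 + 2 * (b * s) + 2 * (c * t) + b * b * form x x + c * c * form y y + 2 * (b * c) * form x y))"
  proof (rule count_sphere_slice_int[OF n st])
    have "(\<Sum>b\<in>residues5. \<Sum>c\<in>residues5. e5 (- (2 * (b * s + c * t))) *
        (if \<forall>i<n. 5 dvd b * x i + c * y i then 5 ^ n else 0))
      = (\<Sum>b\<in>residues5. if b = 0 then \<Sum>c\<in>residues5. if c = 0 then 5 ^ n else 0 else 0)"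
    proof (intro sum.cong refl)
      fix b assume b: "b \<in> residues5"
      have "e5 (- (2 * (b * s + c * t))) * (if \<forall>i<n. 5 dvd b * x i + c * y i then 5 ^ n else 0)
        = (if b = 0 then if c = 0 then 5 ^ n else 0 else 0)" if "c \<in> residues5" for c
        using ind b that unfolding independent_def by auto
      then show "(\<Sum>c\<in>residues5. e5 (- (2 * (b * s + c * t))) * (if \<forall>i<n. 5 dvd b * x i + c * y i then 5 ^ n else 0))
        = (if b = 0 then \<Sum>c\<in>residues5. if c = 0 then 5 ^ n else 0 else 0)"
        by (simp cong: sum.cong)
    qed
    also have "\<dots> = of_int 1 * 5 ^ n"
      by (simp add: sum.delta residues5_def)
    finally show "(\<Sum>b\<in>residues5. \<Sum>c\<in>residues5. e5 (- (2 * (b * s + c * t))) *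
        (if \<forall>i<n. 5 dvd b * x i + c * y i then 5 ^ n else 0)) = of_int 1 * 5 ^ n" .
  qed
  also have "(\<Sum>b\<in>residues5. \<Sum>c\<in>residues5.
        chi5 (1 + 2 * (b * s) + 2 * (c * t) + b * b * form x x + c * c * form y y + 2 * (b * c) * form x y))
      = slice_sum (form x y) s t"
    unfolding slice_sum_def
  proof (intro sum.cong refl chi5_mod mod_add_cong)
    fix b c :: int
    have "b * b * form x x mod 5 = b * b * 1 mod 5" "c * c * form y y mod 5 = c * c * 1 mod 5"
      by (rule mod_mult_cong[OF refl]; simp add: form_xy)+
    then show "b * b * form x x mod 5 = b * b mod 5" "c * c * form y y mod 5 = c * c mod 5"
      by simp_all
  qed
  finally show ?thesis
    by simp
qed

lemma card_in_rel:
  assumes n: "n = 2 * m + 5" and x: "x \<in> sphere"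
  shows "int (card {z \<in> sphere. in_rel {0} x z}) = 125 * 5 ^ m * 5 ^ m - 5 * disc * 5 ^ m"
    and "int (card {z \<in> sphere. in_rel {2, 3} x z}) = 250 * 5 ^ m * 5 ^ m - 10 * disc * 5 ^ m"
    and "int (card {z \<in> sphere. in_rel {1, 2, 3, 4} x z}) = 500 * 5 ^ m * 5 ^ m + 30 * disc * 5 ^ m"
proof -
  have *: "int (card {z \<in> sphere. in_rel S x z}) = (\<Sum>s\<in>S.
      125 * 5 ^ m * 5 ^ m + 5 * disc * 5 ^ m * (\<Sum>b\<in>residues5. chi5 (1 + 2 * (b * s) + b * b)))"
    if "S \<subseteq> {0..4}" for S
  proof -
    have "finite S"
      using that finite_subset by blast
    \<comment> \<open>The trivial condition on the unit type fills the second slot of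
      \<open>card_slices\<close>.\<close>
    have "{z \<in> sphere. in_rel S x z} = {z \<in> sphere. form x z mod 5 \<in> S \<and> () \<in> {()}}"
      by (simp add: in_rel_def)
    then have "int (card {z \<in> sphere. in_rel S x z}) = (\<Sum>s\<in>S. int (card {z \<in> sphere. form x z mod 5 = s}))"
      using \<open>finite S\<close> by (simp only: card_slices[OF finite_sphere] finite.intros) simp
    also have "\<dots> = (\<Sum>s\<in>S.
      125 * 5 ^ m * 5 ^ m + 5 * disc * 5 ^ m * (\<Sum>b\<in>residues5. chi5 (1 + 2 * (b * s) + b * b)))"
      using that by (intro sum.cong refl card_sphere_slice[OF n x]) auto
    finally show ?thesis .
  qed
  show "int (card {z \<in> sphere. in_rel {0} x z}) = 125 * 5 ^ m * 5 ^ m - 5 * disc * 5 ^ m"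
    "int (card {z \<in> sphere. in_rel {2, 3} x z}) = 250 * 5 ^ m * 5 ^ m - 10 * disc * 5 ^ m"
    "int (card {z \<in> sphere. in_rel {1, 2, 3, 4} x z}) = 500 * 5 ^ m * 5 ^ m + 30 * disc * 5 ^ m"
    by (subst *; simp add: residues5_def chi5_def)+
qed

lemma card_in_rel2:
  assumes n: "n = 2 * m + 5" and x: "x \<in> sphere" and y: "y \<in> sphere" and ind: "independent x y"
    and S: "S \<subseteq> {0..4}"
  shows "int (card {z \<in> sphere. in_rel S x z \<and> in_rel S y z})
    = 25 * 5 ^ m * 5 ^ m * (int (card S))\<^sup>2 + disc * 5 ^ m * (\<Sum>s\<in>S. \<Sum>t\<in>S. slice_sum (form x y) s t)"
proof -
  have "finite S"
    using S finite_subset by blast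
  then have "int (card {z \<in> sphere. in_rel S x z \<and> in_rel S y z})
    = (\<Sum>s\<in>S. \<Sum>t\<in>S. int (card {z \<in> sphere. form x z mod 5 = s \<and> form y z mod 5 = t}))"
    by (simp add: in_rel_def card_slices[OF finite_sphere])
  also have "\<dots> = (\<Sum>s\<in>S. \<Sum>t\<in>S. 25 * 5 ^ m * 5 ^ m + disc * 5 ^ m * slice_sum (form x y) s t)"
    using S by (intro sum.cong refl card_sphere_slice2[OF n x y ind]) auto
  finally show ?thesis
    by (simp add: sum.distrib sum_distrib_left power2_eq_square algebra_simps)
qed

section \<open>Antipodal pairs\<close>

definition neg :: "(nat \<Rightarrow> int) \<Rightarrow> nat \<Rightarrow> int" where
  "neg x = restrict (\<lambda>i. - x i) {..<n}"

lemma form_neg_left [simp]: "form (neg x) z = - form x z"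
  by (simp add: form_def neg_def sum_negf)

lemma form_neg_right [simp]: "form z (neg x) = - form z x"
  by (metis form_commute form_neg_left)

lemma neg_vecs: "x \<in> vecs \<Longrightarrow> neg x \<in> vecs"
  unfolding vecs_def neg_def by (auto simp: PiE_iff residues5_uminus)

lemma neg_sphere: "x \<in> sphere \<Longrightarrow> neg x \<in> sphere"
  by (simp add: sphere_def neg_vecs)

lemma neg_neg: "x \<in> sphere \<Longrightarrow> neg (neg x) = x"
  by (auto simp: sphere_def vecs_def neg_def fun_eq_iff PiE_iff extensional_def)

lemma neg_neq: "x \<in> sphere \<Longrightarrow> neg x \<noteq> x"
proof
  assume "x \<in> sphere" "neg x = x"
  then have "form x x = - form x x" "form x x mod 5 = 1"
    using form_neg_left[of x x] by (simp_all add: sphere_def)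
  then show False
    by simp
qed

lemma vecs_eqI:
  assumes "x \<in> vecs" "y \<in> vecs" "\<And>i. i < n \<Longrightarrow> 5 dvd x i - y i"
  shows "x = y"
proof (rule PiE_ext)
  show "x \<in> (\<Pi>\<^sub>E i\<in>{..<n}. residues5)" "y \<in> (\<Pi>\<^sub>E i\<in>{..<n}. residues5)"
    using assms by (simp_all add: vecs_def)
  then show "x i = y i" if "i \<in> {..<n}" for i
    using assms(3) that by (intro residues5_eq) (auto simp: PiE_iff)
qed

text \<open>Pairing a relation between \<open>x\<close> and \<open>y\<close> with both vectors shows
  that the coefficients have equal squares, since both have norm 1. So \<open>b\<close> and
  \<open>c\<close> agree up to sign, and a nonzero coefficient could be cancelled, giving
  \<open>x = y\<close> or \<open>x = neg y\<close>.\<close>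

lemma sphere_independent:
  assumes x: "x \<in> sphere" and y: "y \<in> sphere" and "x \<noteq> y" "x \<noteq> neg y"
  shows "independent x y"
  unfolding independent_def
proof (intro ballI impI)
  fix b c assume bc: "b \<in> residues5" "c \<in> residues5" and dep: "\<forall>i<n. 5 dvd b * x i + c * y i"
  have prime5: "prime (5::int)"
    by simp
  have xy: "x \<in> vecs" "y \<in> vecs" "neg y \<in> vecs" "form x x mod 5 = 1" "form y y mod 5 = 1"
    using x y neg_sphere by (auto simp: sphere_def)
  have "5 dvd form (\<lambda>i. b * x i + c * y i) z" for z
    using form_cong_mod[of "\<lambda>i. b * x i + c * y i" "\<lambda>i. 0" z] dep by simp
  then have "5 dvd b * (b * form x x + c * form y x) - c * (b * form x y + c * form y y)"
    using form_combination_left by (intro dvd_diff dvd_mult) metis+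
  then have "5 dvd b * b * form x x - c * c * form y y"
    by (simp add: form_commute[of y x] algebra_simps)
  moreover have "(b * b * form x x - c * c * form y y) mod 5 = (b * b * 1 - c * c * 1) mod 5"
    using xy by (intro mod_diff_cong mod_mult_cong) auto
  ultimately have "5 dvd b * b * 1 - c * c * 1"
    by (simp only: dvd_eq_mod_eq_0)
  then have "5 dvd (b - c) * (b + c)"
    by (simp add: algebra_simps)
  then have "5 dvd b - c \<or> 5 dvd b - - c"
    using prime5 by (simp add: prime_dvd_mult_iff)
  then consider "b = c" | "b = - c"
    using bc residues5_eq residues5_uminus by blast
  then show "b = 0 \<and> c = 0"
  proof cases
    case 1
    have "b = 0"
    proof (rule ccontr)
      assume "b \<noteq> 0"
      then have "\<not> 5 dvd b"
        using bc by (auto simp: residues5_def)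
      have "5 dvd x i - neg y i" if "i < n" for i
      proof -
        have "5 dvd b * (x i + y i)"
          using dep that 1 by (simp add: algebra_simps)
        then show ?thesis
          using \<open>\<not> 5 dvd b\<close> prime5 that by (simp add: prime_dvd_mult_iff neg_def)
      qed
      then show False
        using vecs_eqI xy \<open>x \<noteq> neg y\<close> by blast
    qed
    with 1 show ?thesis
      by simp
  next
    case 2
    have "c = 0"
    proof (rule ccontr)
      assume "c \<noteq> 0"
      then have "\<not> 5 dvd c"
        using bc by (auto simp: residues5_def)
      have "5 dvd x i - y i" if "i < n" for i
      proof -
        have "5 dvd c * (y i - x i)"
          using dep that 2 by (simp add: algebra_simps)
        then show ?thesis
          using \<open>\<not> 5 dvd c\<close> prime5 by (simp add: prime_dvd_mult_iff dvd_diff_commute)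
      qed
      then show False
        using vecs_eqI xy \<open>x \<noteq> y\<close> by blast
    qed
    with 2 show ?thesis
      by simp
  qed
qed

text \<open>Instead of a quotient by sign, one point is selected from each antipodal pair, namely
  the one with the smaller number in an injective numbering.\<close>

lemma ex_half_sphere:
  obtains R where "R \<subseteq> sphere" "\<And>x. x \<in> R \<Longrightarrow> neg x \<notin> R" "\<And>x. x \<in> sphere \<Longrightarrow> x \<in> R \<or> neg x \<in> R"
proof -
  obtain h :: "(nat \<Rightarrow> int) \<Rightarrow> nat" where h: "inj_on h sphere"
    using finite_imp_inj_to_nat_seg[OF finite_sphere] by blast
  let ?R = "{x \<in> sphere. h x < h (neg x)}"
  have "x \<in> ?R \<or> neg x \<in> ?R" if "x \<in> sphere" for x
  proof -
    have "h x \<noteq> h (neg x)"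
      using h that neg_sphere neg_neq by (metis inj_onD)
    then show ?thesis
      using that neg_sphere neg_neg by auto
  qed
  moreover have "neg x \<notin> ?R" if "x \<in> ?R" for x
    using that neg_neg by auto
  ultimately show thesis
    using that[of ?R] by blast
qed

end

section \<open>The graphs\<close>

text \<open>All counting is done in \<open>A\<close>; the map \<open>h\<close> only transports the
  vertices to another type, in the end the natural numbers.\<close>

definition rel_graph :: "('a \<Rightarrow> 'b) \<Rightarrow> 'a set \<Rightarrow> ('a \<Rightarrow> 'a \<Rightarrow> bool) \<Rightarrow> 'b pair_pre_digraph" where
  "rel_graph h A P = \<lparr> pverts = h ` A, parcs = {(h x, h y) | x y. x \<in> A \<and> y \<in> A \<and> P x y} \<rparr>"

lemma pverts_rel_graph [simp]: "pverts (rel_graph h A P) = h ` A"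
  by (simp add: rel_graph_def)

lemma rel_graph_cong:
  assumes "\<And>x y. x \<in> A \<Longrightarrow> y \<in> A \<Longrightarrow> P x y \<longleftrightarrow> Q x y"
  shows "rel_graph h A P = rel_graph h A Q"
proof -
  have "{(h x, h y) | x y. x \<in> A \<and> y \<in> A \<and> P x y} = {(h x, h y) | x y. x \<in> A \<and> y \<in> A \<and> Q x y}"
    using assms by blast
  then show ?thesis
    by (simp add: rel_graph_def)
qed

locale relation_on_finite =
  fixes h :: "'a \<Rightarrow> 'b" and A :: "'a set" and P :: "'a \<Rightarrow> 'a \<Rightarrow> bool"
  assumes finite_A: "finite A" and inj: "inj_on h A"
    and P_sym: "\<And>x y. x \<in> A \<Longrightarrow> y \<in> A \<Longrightarrow> P x y \<Longrightarrow> P y x"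
    and P_irrefl: "\<And>x. x \<in> A \<Longrightarrow> \<not> P x x"
begin

lemma pair_graph_rel_graph: "pair_graph (rel_graph h A P)"
proof -
  have "parcs (rel_graph h A P) \<subseteq> h ` A \<times> h ` A"
    by (auto simp: rel_graph_def)
  then have "finite (parcs (rel_graph h A P))"
    using finite_A by (meson finite_SigmaI finite_imageI finite_subset)
  moreover have "symmetric (with_proj (rel_graph h A P))"
    using P_sym by (auto simp: rel_graph_def symmetric_def intro!: symI)
  moreover have "fst e \<noteq> snd e" if e: "e \<in> parcs (rel_graph h A P)" for e
  proof -
    obtain x y where xy: "e = (h x, h y)" "x \<in> A" "y \<in> A" "P x y"
      using e by (auto simp: rel_graph_def)
    then have "x \<noteq> y"
      using P_irrefl by blast
    then show ?thesis
      using xy by (simp add: inj_on_eq_iff[OF inj])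
  qed
  moreover have "fst e \<in> pverts (rel_graph h A P)" "snd e \<in> pverts (rel_graph h A P)"
    if "e \<in> parcs (rel_graph h A P)" for e
    using that by (auto simp: rel_graph_def)
  moreover have "finite (pverts (rel_graph h A P))"
    using finite_A by simp
  ultimately show ?thesis
    by unfold_locales
qed

lemma arc_rel_graph: "x \<in> A \<Longrightarrow> y \<in> A \<Longrightarrow> (h x, h y) \<in> parcs (rel_graph h A P) \<longleftrightarrow> P x y"
  using inj_on_eq_iff[OF inj] unfolding rel_graph_def by auto

lemma neighbours_rel_graph: "x \<in> A \<Longrightarrow> neighbours (rel_graph h A P) (h x) = h ` {y \<in> A. P x y}"
  using inj_on_eq_iff[OF inj] unfolding neighbours_def rel_graph_def by auto

lemma degree_rel_graph:
  "x \<in> A \<Longrightarrow> card (neighbours (rel_graph h A P) (h x)) = card {y \<in> A. P x y}"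
  by (simp add: neighbours_rel_graph card_image inj_on_subset[OF inj])

lemma common_nbrs_rel_graph:
  assumes "x \<in> A" "y \<in> A"
  shows "common_nbrs (rel_graph h A P) (h x) (h y) = int (card {z \<in> A. P x z \<and> P y z})"
proof -
  have "h ` {z \<in> A. P x z} \<inter> h ` {z \<in> A. P y z} = h ` {z \<in> A. P x z \<and> P y z}"
    using inj_on_eq_iff[OF inj] by auto
  then show ?thesis
    using assms by (simp add: common_nbrs_def neighbours_rel_graph card_image inj_on_subset[OF inj])
qed

lemma regular_rel_graph:
  assumes "\<And>x. x \<in> A \<Longrightarrow> int (card {y \<in> A. P x y}) = k"
  shows "regular_graph (rel_graph h A P) k"
  using assms by (auto simp: regular_graph_def pair_graph_rel_graph degree_rel_graph)

lemma card_pverts_rel_graph: "card (pverts (rel_graph h A P)) = card A"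
  by (simp add: card_image inj)

lemma strongly_regular_rel_graph:
  assumes "int (card A) = N" and "\<And>x. x \<in> A \<Longrightarrow> int (card {y \<in> A. P x y}) = k"
    and "\<And>x y. x \<in> A \<Longrightarrow> y \<in> A \<Longrightarrow> P x y \<Longrightarrow> int (card {z \<in> A. P x z \<and> P y z}) = l"
    and "\<And>x y. x \<in> A \<Longrightarrow> y \<in> A \<Longrightarrow> x \<noteq> y \<Longrightarrow> \<not> P x y \<Longrightarrow> int (card {z \<in> A. P x z \<and> P y z}) = m"
  shows "strongly_regular (rel_graph h A P) N k l m"
  unfolding strongly_regular_def
proof (intro conjI ballI impI)
  show "regular_graph (rel_graph h A P) k"
    using assms(2) by (rule regular_rel_graph)
  show "int (card (pverts (rel_graph h A P))) = N"
    unfolding card_pverts_rel_graph by (rule assms(1))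
next
  fix u v assume "u \<in> pverts (rel_graph h A P)" "v \<in> pverts (rel_graph h A P)"
  then obtain x y where xy: "u = h x" "v = h y" "x \<in> A" "y \<in> A"
    by auto
  show "common_nbrs (rel_graph h A P) u v = l" if "(u, v) \<in> parcs (rel_graph h A P)"
    using that assms(3) xy by (simp only: common_nbrs_rel_graph arc_rel_graph)
  show "common_nbrs (rel_graph h A P) u v = m" if "u \<noteq> v \<and> (u, v) \<notin> parcs (rel_graph h A P)"
  proof -
    have "x \<noteq> y" "\<not> P x y"
      using that xy by (auto simp: arc_rel_graph)
    then show ?thesis
      using assms(4) xy by (simp only: common_nbrs_rel_graph)
  qed
qed

text \<open>Children are again graphs of relations on \<open>A\<close>, so their parameters can be
  computed by the same counts.\<close>

lemma deza_child_rel_graph: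
  "deza_child (rel_graph h A P) c
    = rel_graph h A (\<lambda>x y. x \<noteq> y \<and> int (card {z \<in> A. P x z \<and> P y z}) = c)"
proof -
  let ?Q = "\<lambda>x y. x \<noteq> y \<and> int (card {z \<in> A. P x z \<and> P y z}) = c"
  have iff: "h x \<noteq> h y \<and> common_nbrs (rel_graph h A P) (h x) (h y) = c \<longleftrightarrow> ?Q x y" if "x \<in> A" "y \<in> A" for x y
    using inj_on_eq_iff[OF inj that] that by (simp add: common_nbrs_rel_graph)
  have "{(u, v). u \<in> h ` A \<and> v \<in> h ` A \<and> u \<noteq> v \<and> common_nbrs (rel_graph h A P) u v = c}
    = {(h x, h y) | x y. x \<in> A \<and> y \<in> A \<and> (h x \<noteq> h y \<and> common_nbrs (rel_graph h A P) (h x) (h y) = c)}"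
    by blast
  also have "\<dots> = {(h x, h y) | x y. x \<in> A \<and> y \<in> A \<and> ?Q x y}"
    using iff by blast
  finally show ?thesis
    by (simp add: deza_child_def rel_graph_def[of h A ?Q])
qed

end

section \<open>Counts on a half sphere\<close>

context diagonal_form
begin

lemma in_rel_commute: "in_rel S x y \<longleftrightarrow> in_rel S y x"
  by (simp add: in_rel_def form_commute)

text \<open>These sets are closed under negation modulo 5, so the relations depend only on the pairs
  {z, -z}.\<close>

lemma in_rel_neg:
  assumes "S \<in> {{0}, {2, 3}, {1, 2, 3, 4}}"
  shows "in_rel S x (neg z) \<longleftrightarrow> in_rel S x z"
  using assms by (auto simp: in_rel_def zmod_zminus1_eq_if)

text \<open>The sphere is the disjoint union of \<open>R\<close> and its image under
  \<open>neg\<close>, and a property invariant under \<open>neg\<close> has equally many points in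
  both.\<close>

lemma card_half_sphere:
  assumes R: "R \<subseteq> sphere" "\<And>x. x \<in> R \<Longrightarrow> neg x \<notin> R" "\<And>x. x \<in> sphere \<Longrightarrow> x \<in> R \<or> neg x \<in> R"
    and P: "\<And>z. P (neg z) \<longleftrightarrow> P z"
  shows "int (card {z \<in> R. P z}) = int (card {z \<in> sphere. P z}) div 2"
proof -
  have fin: "finite {z \<in> R. P z}"
    using finite_subset[OF R(1) finite_sphere] by simp
  have sphere_split: "{z \<in> sphere. P z} = {z \<in> R. P z} \<union> neg ` {z \<in> R. P z}"
  proof (intro equalityI subsetI)
    fix z assume z: "z \<in> {z \<in> sphere. P z}"
    then have "z = neg (neg z)"
      by (simp add: neg_neg)
    with z R(3)[of z] P[of z] show "z \<in> {z \<in> R. P z} \<union> neg ` {z \<in> R. P z}"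
      by blast
  next
    fix z assume "z \<in> {z \<in> R. P z} \<union> neg ` {z \<in> R. P z}"
    then show "z \<in> {z \<in> sphere. P z}"
      using R(1) P neg_sphere by auto
  qed
  have "card {z \<in> sphere. P z} = card {z \<in> R. P z} + card (neg ` {z \<in> R. P z})"
    unfolding sphere_split using R(2) fin by (intro card_Un_disjoint) auto
  also have "card (neg ` {z \<in> R. P z}) = card {z \<in> R. P z}"
  proof (rule card_image)
    have "inj_on neg sphere"
      by (rule inj_on_inverseI[of _ neg neg]) (rule neg_neg)
    then show "inj_on neg {z \<in> R. P z}"
      by (rule inj_on_subset) (use R(1) in auto)
  qed
  finally show ?thesis
    by simp
qed

end

text \<open>\<open>R\<close> provides the vertices. \<open>X\<close> is a symbol for
  \<open>5 ^ m\<close>, which makes the counts polynomials in \<open>X\<close> and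
  \<open>disc\<close>.\<close>

locale half_sphere = diagonal_form n w for n :: nat and w :: "nat \<Rightarrow> int" +
  fixes m :: nat and R :: "(nat \<Rightarrow> int) set" and X :: int
  assumes n_eq: "n = 2 * m + 5" and X_eq: "X = 5 ^ m"
    and R_subset: "R \<subseteq> sphere" and R_neg: "\<And>x. x \<in> R \<Longrightarrow> neg x \<notin> R"
    and R_cover: "\<And>x. x \<in> sphere \<Longrightarrow> x \<in> R \<or> neg x \<in> R"
begin

lemma finite_R: "finite R"
  using finite_subset[OF R_subset finite_sphere] .

lemma form_self: "x \<in> R \<Longrightarrow> form x x mod 5 = 1"
  using R_subset by (auto simp: sphere_def)

lemma card_R_eq:
  assumes "\<And>z. P (neg z) \<longleftrightarrow> P z"
  shows "int (card {z \<in> R. P z}) = int (card {z \<in> sphere. P z}) div 2"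
  using R_subset R_neg R_cover assms by (rule card_half_sphere)

text \<open>The two numbers of common neighbours differ by \<open>5 * disc * X\<close>, so this
  keeps the two children apart.\<close>

lemma disc_X_neq: "disc * X \<noteq> 0"
proof -
  have "chi5 (w i) \<noteq> 0" if "i < n" for i
    using weight[OF that] by (auto simp: chi5_def)
  then show ?thesis
    by (simp add: disc_def X_eq)
qed

lemma card_R: "int (card R) = (625 * X * X + disc * (25 * X)) div 2"
  using card_R_eq[of "\<lambda>_. True"] card_sphere[OF n_eq] by (simp add: X_eq mult.commute mult.left_commute)

text \<open>The third count includes \<open>x\<close> itself, whose product with itself is 1 modulo
  5.\<close>

lemma degrees:
  assumes "x \<in> R"
  shows "int (card {z \<in> R. in_rel {0} x z}) = (125 * X * X - disc * (5 * X)) div 2"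
    "int (card {z \<in> R. in_rel {2, 3} x z}) = 125 * X * X - disc * (5 * X)"
    "int (card {z \<in> R. in_rel {1, 2, 3, 4} x z}) = 250 * X * X + 15 * (disc * X)"
proof -
  have x: "x \<in> sphere"
    using assms R_subset by blast
  note card = card_in_rel[OF n_eq x, folded X_eq]
  have half: "int (card {z \<in> R. in_rel S x z}) = int (card {z \<in> sphere. in_rel S x z}) div 2"
    if "S \<in> {{0}, {2, 3}, {1, 2, 3, 4}}" for S
    by (rule card_R_eq) (rule in_rel_neg[OF that])
  have "int (card {z \<in> R. in_rel {0} x z}) = (125 * X * X - 5 * disc * X) div 2"
    by (subst half) (simp_all only: card insert_iff simp_thms)
  then show "int (card {z \<in> R. in_rel {0} x z}) = (125 * X * X - disc * (5 * X)) div 2"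
    by (simp add: mult.assoc mult.left_commute)
  have "int (card {z \<in> R. in_rel {2, 3} x z}) = (250 * X * X - 10 * disc * X) div 2"
    by (subst half) (simp_all only: card insert_iff simp_thms)
  also have "250 * X * X - 10 * disc * X = 2 * (125 * X * X - disc * (5 * X))"
    by simp
  finally show "int (card {z \<in> R. in_rel {2, 3} x z}) = 125 * X * X - disc * (5 * X)"
    by simp
  have "int (card {z \<in> R. in_rel {1, 2, 3, 4} x z}) = (500 * X * X + 30 * disc * X) div 2"
    by (subst half) (simp_all only: card insert_iff simp_thms)
  also have "500 * X * X + 30 * disc * X = 2 * (250 * X * X + 15 * (disc * X))"
    by simp
  finally show "int (card {z \<in> R. in_rel {1, 2, 3, 4} x z}) = 250 * X * X + 15 * (disc * X)"
    by simp
qed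

text \<open>Distinct points of \<open>R\<close> are not antipodal, hence independent, and the count
  on the sphere is halved. If \<open>x\<close> and \<open>y\<close> are not orthogonal, the third
  set contains both of them.\<close>

lemma common_neighbours:
  assumes xy: "x \<in> R" "y \<in> R" "x \<noteq> y"
  shows "int (card {z \<in> R. in_rel {0} x z \<and> in_rel {0} y z})
      = (25 * X * X + disc * X * (if in_rel {0} x y then 5 else -5)) div 2"
    "int (card {z \<in> R. in_rel {2, 3} x z \<and> in_rel {2, 3} y z})
      = 50 * X * X - disc * X * (if in_rel {0} x y then 10 else 5)"
    "int (card {z \<in> R. in_rel {1, 2, 3, 4} x z \<and> in_rel {1, 2, 3, 4} y z})
      = 200 * X * X + disc * X * (if in_rel {0} x y then 20 else 15)"
proof -
  have S: "x \<in> sphere" "y \<in> sphere"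
    using xy R_subset by auto
  have "x \<noteq> neg y"
    using xy R_neg by blast
  note card = card_in_rel2[OF n_eq S sphere_independent[OF S \<open>x \<noteq> y\<close> this], folded X_eq]
  have iff: "in_rel {0} x y \<longleftrightarrow> form x y mod 5 = 0"
    by (simp add: in_rel_def)
  have half2: "int (card {z \<in> R. in_rel S x z \<and> in_rel S y z})
      = (25 * X * X * (int (card S))\<^sup>2 + disc * X * (\<Sum>s\<in>S. \<Sum>t\<in>S. slice_sum (form x y) s t)) div 2"
    if "S \<in> {{0}, {2, 3}, {1, 2, 3, 4}}" for S
  proof -
    have "S \<subseteq> {0..4}"
      using that by auto
    then show ?thesis
      using card_R_eq[of "\<lambda>z. in_rel S x z \<and> in_rel S y z"] card[of S] in_rel_neg[OF that] by simp
  qed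
  show "int (card {z \<in> R. in_rel {0} x z \<and> in_rel {0} y z})
    = (25 * X * X + disc * X * (if in_rel {0} x y then 5 else -5)) div 2"
    by (subst half2) (simp_all add: slice_sum_table iff)
  have "int (card {z \<in> R. in_rel {2, 3} x z \<and> in_rel {2, 3} y z})
    = (25 * X * X * (int (card {2, 3 :: int}))\<^sup>2 + disc * X * (if in_rel {0} x y then -20 else -10)) div 2"
    by (subst half2) (simp_all only: slice_sum_table iff insert_iff simp_thms)
  also have "25 * X * X * (int (card {2, 3 :: int}))\<^sup>2 + disc * X * (if in_rel {0} x y then -20 else -10)
    = 2 * (50 * X * X - disc * X * (if in_rel {0} x y then 10 else 5))"
    by simp
  finally show "int (card {z \<in> R. in_rel {2, 3} x z \<and> in_rel {2, 3} y z})
    = 50 * X * X - disc * X * (if in_rel {0} x y then 10 else 5)"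
    by simp
  have "int (card {z \<in> R. in_rel {1, 2, 3, 4} x z \<and> in_rel {1, 2, 3, 4} y z})
    = (25 * X * X * (int (card {1, 2, 3, 4 :: int}))\<^sup>2 + disc * X * (if in_rel {0} x y then 40 else 30)) div 2"
    by (subst half2) (simp_all only: slice_sum_table iff insert_iff simp_thms)
  also have "25 * X * X * (int (card {1, 2, 3, 4 :: int}))\<^sup>2 + disc * X * (if in_rel {0} x y then 40 else 30)
    = 2 * (200 * X * X + disc * X * (if in_rel {0} x y then 20 else 15))"
    by simp
  finally show "int (card {z \<in> R. in_rel {1, 2, 3, 4} x z \<and> in_rel {1, 2, 3, 4} y z})
    = 200 * X * X + disc * X * (if in_rel {0} x y then 20 else 15)"
    by simp
qed

lemma in_rel_cases:
  "in_rel {1, 2, 3, 4} x y \<longleftrightarrow> \<not> in_rel {0} x y" "in_rel {2, 3} x y \<Longrightarrow> \<not> in_rel {0} x y"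
  unfolding in_rel_def by (cases "form x y" rule: mod5_cases; simp)+

lemma in_rel_self:
  assumes "x \<in> R"
  shows "\<not> in_rel {0} x x" "\<not> in_rel {2, 3} x x" "in_rel {1, 2, 3, 4} x x"
  using form_self[OF assms] by (simp_all add: in_rel_def)

end

section \<open>The Deza graph and its two children\<close>

locale embedded_half_sphere = half_sphere n w m R X
  for n :: nat and w :: "nat \<Rightarrow> int" and m :: nat and R :: "(nat \<Rightarrow> int) set" and X :: int +
  fixes h :: "(nat \<Rightarrow> int) \<Rightarrow> 'b"
  assumes inj_h: "inj_on h R"
begin

abbreviation G :: "'b pair_pre_digraph" where
  "G \<equiv> rel_graph h R (in_rel {2, 3})"

sublocale graph: relation_on_finite h R "in_rel {2, 3}"
  using finite_R inj_h in_rel_self in_rel_commute by unfold_locales blast+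

sublocale child_a: relation_on_finite h R "in_rel {0}"
  using finite_R inj_h in_rel_self in_rel_commute by unfold_locales blast+

sublocale child_b: relation_on_finite h R "\<lambda>x y. x \<noteq> y \<and> in_rel {1, 2, 3, 4} x y"
  using finite_R inj_h in_rel_commute by unfold_locales blast+

lemma regular_G: "regular_graph G (125 * X * X - disc * (5 * X))"
  using degrees(2) by (rule graph.regular_rel_graph)

lemma deza_G: "deza_graph G ((625 * X * X + disc * (25 * X)) div 2) (125 * X * X - disc * (5 * X))
    (2 * (25 * X * X - disc * (5 * X))) (2 * (25 * X * X) - disc * (5 * X))"
  unfolding deza_graph_def
proof (intro conjI ballI impI)
  show "int (card (pverts G)) = (625 * X * X + disc * (25 * X)) div 2"
    unfolding graph.card_pverts_rel_graph by (rule card_R)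
  fix u v assume "u \<in> pverts G" "v \<in> pverts G" "u \<noteq> v"
  then obtain x y where "u = h x" "v = h y" "x \<in> R" "y \<in> R" "x \<noteq> y"
    by auto
  then show "common_nbrs G u v \<in> {2 * (25 * X * X) - disc * (5 * X), 2 * (25 * X * X - disc * (5 * X))}"
    by (simp add: graph.common_nbrs_rel_graph common_neighbours(2))
qed (rule regular_G)

text \<open>Adjacent vertices are never orthogonal, so only one of the two possible numbers of
  common neighbours occurs on edges.\<close>

lemma edge_regular_G: "edge_regular G"
  unfolding edge_regular_def
proof (intro conjI exI ballI impI)
  fix u v assume "u \<in> pverts G" "v \<in> pverts G" and uv: "(u, v) \<in> parcs G"
  then obtain x y where xy: "u = h x" "v = h y" "x \<in> R" "y \<in> R"
    by auto
  with uv have "in_rel {2, 3} x y"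
    by (simp add: graph.arc_rel_graph)
  then have "x \<noteq> y" "\<not> in_rel {0} x y"
    using xy in_rel_self(2) in_rel_cases(2) by blast+
  with xy show "common_nbrs G u v = 50 * X * X - disc * X * 5"
    by (simp add: graph.common_nbrs_rel_graph common_neighbours(2))
qed (rule regular_G)

text \<open>The number of common neighbours recognises orthogonality, so this child is the
  orthogonality graph.\<close>

lemma child_a_G: "strongly_regular (deza_child G (2 * (25 * X * X - disc * (5 * X))))
    ((625 * X * X + disc * (25 * X)) div 2) ((125 * X * X - disc * (5 * X)) div 2)
    ((25 * X * X + disc * (5 * X)) div 2) ((25 * X * X - disc * (5 * X)) div 2)"
proof -
  have "deza_child G (2 * (25 * X * X - disc * (5 * X))) = rel_graph h R (in_rel {0})"
    unfolding graph.deza_child_rel_graph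
  proof (rule rel_graph_cong)
    fix x y assume "x \<in> R" "y \<in> R"
    then show "x \<noteq> y \<and> int (card {z \<in> R. in_rel {2, 3} x z \<and> in_rel {2, 3} y z})
        = 2 * (25 * X * X - disc * (5 * X)) \<longleftrightarrow> in_rel {0} x y"
      using in_rel_self(1) disc_X_neq by (cases "x = y") (simp_all add: common_neighbours(2))
  qed
  moreover have "strongly_regular (rel_graph h R (in_rel {0}))
    ((625 * X * X + disc * (25 * X)) div 2) ((125 * X * X - disc * (5 * X)) div 2)
    ((25 * X * X + disc * (5 * X)) div 2) ((25 * X * X - disc * (5 * X)) div 2)"
  proof (rule child_a.strongly_regular_rel_graph[OF card_R degrees(1)])
    fix x y assume xy: "x \<in> R" "y \<in> R" "in_rel {0} x y"
    then have "x \<noteq> y"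
      using in_rel_self(1) by blast
    with xy show "int (card {z \<in> R. in_rel {0} x z \<and> in_rel {0} y z}) = (25 * X * X + disc * (5 * X)) div 2"
      by (simp add: common_neighbours(1) mult.commute mult.left_commute)
  next
    fix x y assume "x \<in> R" "y \<in> R" "x \<noteq> y" "\<not> in_rel {0} x y"
    then show "int (card {z \<in> R. in_rel {0} x z \<and> in_rel {0} y z}) = (25 * X * X - disc * (5 * X)) div 2"
      by (simp add: common_neighbours(1) mult.commute mult.left_commute)
  qed
  ultimately show ?thesis
    by simp
qed

text \<open>This child is the complement of the orthogonality graph; its parameters come from the
  third counts after discarding the vertices that are related to themselves.\<close>

lemma child_b_G: "strongly_regular (deza_child G (2 * (25 * X * X) - disc * (5 * X)))
    ((625 * X * X + disc * (25 * X)) div 2) (2 * (125 * X * X) + 3 * disc * (5 * X) - 1)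
    (8 * (25 * X * X) + 3 * disc * (5 * X) - 2) (8 * (25 * X * X) + 4 * disc * (5 * X))"
proof -
  let ?Q = "\<lambda>x y. x \<noteq> y \<and> in_rel {1, 2, 3, 4} x y"
  have "deza_child G (2 * (25 * X * X) - disc * (5 * X)) = rel_graph h R ?Q"
    unfolding graph.deza_child_rel_graph
  proof (rule rel_graph_cong)
    fix x y assume "x \<in> R" "y \<in> R"
    then show "x \<noteq> y \<and> int (card {z \<in> R. in_rel {2, 3} x z \<and> in_rel {2, 3} y z})
        = 2 * (25 * X * X) - disc * (5 * X) \<longleftrightarrow> x \<noteq> y \<and> in_rel {1, 2, 3, 4} x y"
      unfolding in_rel_cases(1) using disc_X_neq by (cases "x = y") (simp_all add: common_neighbours(2))
  qed
  moreover have "strongly_regular (rel_graph h R ?Q)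
    ((625 * X * X + disc * (25 * X)) div 2) (2 * (125 * X * X) + 3 * disc * (5 * X) - 1)
    (8 * (25 * X * X) + 3 * disc * (5 * X) - 2) (8 * (25 * X * X) + 4 * disc * (5 * X))"
  proof (rule child_b.strongly_regular_rel_graph[OF card_R])
    fix x assume x: "x \<in> R"
    have "{z \<in> R. ?Q x z} = {z \<in> R. in_rel {1, 2, 3, 4} x z} - {x}"
      by auto
    moreover have "x \<in> {z \<in> R. in_rel {1, 2, 3, 4} x z}" "finite {z \<in> R. in_rel {1, 2, 3, 4} x z}"
      using x in_rel_self(3) finite_R by simp_all
    ultimately have "Suc (card {z \<in> R. ?Q x z}) = card {z \<in> R. in_rel {1, 2, 3, 4} x z}"
      by (simp only: card_Suc_Diff1)
    then have "int (card {z \<in> R. ?Q x z}) + 1 = int (card {z \<in> R. in_rel {1, 2, 3, 4} x z})"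
      by linarith
    then show "int (card {z \<in> R. ?Q x z}) = 2 * (125 * X * X) + 3 * disc * (5 * X) - 1"
      using degrees(3)[OF x] by simp
  next
    fix x y assume xy: "x \<in> R" "y \<in> R" "?Q x y"
    let ?C = "{z \<in> R. in_rel {1, 2, 3, 4} x z \<and> in_rel {1, 2, 3, 4} y z}"
    have C: "{x, y} \<subseteq> ?C"
      using xy in_rel_self(3)[of x] in_rel_self(3)[of y] in_rel_commute[of _ x y] by blast
    \<comment> \<open>Both vertices lie in \<open>?C\<close>, which explains the -2 in the
      parameter.\<close>
    have "{z \<in> R. ?Q x z \<and> ?Q y z} = ?C - {x, y}"
      by auto
    moreover have "card (?C - {x, y}) = card ?C - card {x, y}"
      using C by (intro card_Diff_subset) auto
    moreover have "card {x, y} \<le> card ?C"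
      using C finite_R by (intro card_mono) auto
    moreover have "card {x, y} = 2"
      using xy by simp
    ultimately have "int (card {z \<in> R. ?Q x z \<and> ?Q y z}) = int (card ?C) - 2"
      by (simp only: of_nat_diff of_nat_numeral)
    also have "int (card ?C) = 200 * X * X + disc * X * 15"
      using xy in_rel_cases(1)[of x y] by (simp add: common_neighbours(3))
    finally show "int (card {z \<in> R. ?Q x z \<and> ?Q y z}) = 8 * (25 * X * X) + 3 * disc * (5 * X) - 2"
      by simp
  next
    fix x y assume xy: "x \<in> R" "y \<in> R" "x \<noteq> y" "\<not> ?Q x y"
    let ?C = "{z \<in> R. in_rel {1, 2, 3, 4} x z \<and> in_rel {1, 2, 3, 4} y z}"
    \<comment> \<open>Here \<open>x\<close> and \<open>y\<close> are orthogonal, so neither lies in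
      \<open>?C\<close> and there is no correction.\<close>
    have "{z \<in> R. ?Q x z \<and> ?Q y z} = ?C"
      using xy in_rel_commute[of _ x y] by blast
    then have "int (card {z \<in> R. ?Q x z \<and> ?Q y z}) = int (card ?C)"
      by simp
    also have "\<dots> = 200 * X * X + disc * X * 20"
      using xy in_rel_cases(1)[of x y] by (simp add: common_neighbours(3))
    finally show "int (card {z \<in> R. ?Q x z \<and> ?Q y z}) = 8 * (25 * X * X) + 4 * disc * (5 * X)"
      by simp
  qed
  ultimately show ?thesis
    by simp
qed

end

section \<open>Choice of the form and translation of the parameters\<close>

theorem mainTheorem1:
  fixes n :: nat and e :: int
  assumes "n > 3" and "odd n" and "e \<in> {-1, 1}"
  shows "\<exists>G :: nat pair_pre_digraph.
    deza_graph G
      ((5 ^ (n - 1) + e * 5 ^ ((n - 1) div 2)) div 2)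
      (5 ^ (n - 2) - e * 5 ^ ((n - 3) div 2))
      (2 * (5 ^ (n - 3) - e * 5 ^ ((n - 3) div 2)))
      (2 * 5 ^ (n - 3) - e * 5 ^ ((n - 3) div 2)) \<and>
    edge_regular G \<and>
    strongly_regular (deza_child G (2 * (5 ^ (n - 3) - e * 5 ^ ((n - 3) div 2))))
      ((5 ^ (n - 1) + e * 5 ^ ((n - 1) div 2)) div 2)
      ((5 ^ (n - 2) - e * 5 ^ ((n - 3) div 2)) div 2)
      ((5 ^ (n - 3) + e * 5 ^ ((n - 3) div 2)) div 2)
      ((5 ^ (n - 3) - e * 5 ^ ((n - 3) div 2)) div 2) \<and>
    strongly_regular (deza_child G (2 * 5 ^ (n - 3) - e * 5 ^ ((n - 3) div 2)))
      ((5 ^ (n - 1) + e * 5 ^ ((n - 1) div 2)) div 2)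
      (2 * 5 ^ (n - 2) + 3 * e * 5 ^ ((n - 3) div 2) - 1)
      (8 * 5 ^ (n - 3) + 3 * e * 5 ^ ((n - 3) div 2) - 2)
      (8 * 5 ^ (n - 3) + 4 * e * 5 ^ ((n - 3) div 2))"
proof -
  obtain m where n: "n = 2 * m + 5"
  proof -
    obtain k where "n = 2 * k + 1"
      using \<open>odd n\<close> by (rule oddE)
    with \<open>n > 3\<close> show thesis
      by (intro that[of "k - 2"]) simp
  qed
  \<comment> \<open>Since 2 is not a square modulo 5, a single weight 2 makes the character of the
    discriminant -1.\<close>
  define w :: "nat \<Rightarrow> int" where "w = (\<lambda>i. if i = 0 \<and> e = -1 then 2 else 1)"
  interpret form: diagonal_form n w
    by unfold_locales (simp add: w_def)
  have "form.disc = (\<Prod>i<n. if i = 0 then e else 1)"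
    unfolding form.disc_def using \<open>e \<in> {-1, 1}\<close> by (intro prod.cong) (auto simp: w_def chi5_def)
  also have "\<dots> = e"
    using n by (simp add: prod.delta)
  finally have disc: "form.disc = e" .
  define X :: int where "X = 5 ^ m"
  have pow: "(5::int) ^ (n - 1) = 625 * X * X" "(5::int) ^ ((n - 1) div 2) = 25 * X"
    "(5::int) ^ (n - 2) = 125 * X * X" "(5::int) ^ (n - 3) = 25 * X * X"
    "(5::int) ^ ((n - 3) div 2) = 5 * X"
  proof -
    have "n - 1 = m + m + 4" "(n - 1) div 2 = m + 2" "n - 2 = m + m + 3" "n - 3 = m + m + 2"
      "(n - 3) div 2 = m + 1"
      using n by simp_all
    then show "(5::int) ^ (n - 1) = 625 * X * X" "(5::int) ^ ((n - 1) div 2) = 25 * X"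
      "(5::int) ^ (n - 2) = 125 * X * X" "(5::int) ^ (n - 3) = 25 * X * X"
      "(5::int) ^ ((n - 3) div 2) = 5 * X"
      by (simp_all only: power_add X_def) simp_all
  qed
  obtain R where R: "R \<subseteq> form.sphere" "\<And>x. x \<in> R \<Longrightarrow> form.neg x \<notin> R" "\<And>x. x \<in> form.sphere \<Longrightarrow> x \<in> R \<or> form.neg x \<in> R"
    by (rule form.ex_half_sphere) (rule that)
  obtain h :: "(nat \<Rightarrow> int) \<Rightarrow> nat" where "inj_on h form.sphere"
    using finite_imp_inj_to_nat_seg[OF form.finite_sphere] by blast
  then have h: "inj_on h R"
    using R(1) by (rule inj_on_subset)
  interpret embedded_half_sphere n w m R X h
    using n X_def R h by unfold_locales
  show ?thesis
    unfolding pow disc[symmetric]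
    by (intro exI[of _ G] conjI deza_G edge_regular_G child_a_G child_b_G)
qed

end
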